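(* Let $f\colon \mathbb{S}^{n\times n}\to\mathbb{R}$ be twice continuously differentiable. A matrix $X\in\mathcal{C}$ is a KKT point of $(\mathrm{P})$ if and only if $S(X)=\nabla f(X)-\operatorname{symblockdiag}(\nabla f(X)X)$ is positive semidefinite. If so, $\hat S=S(X)$ is the unique dual certificate, i.e., the unique matrix $\hat S$ satisfying the KKT conditions at $X$ (together with some $\hat\Lambda$).
   Context: Integers satisfy $m\ge 1$, $d\ge 1$, $n=md$. $\mathbb{S}^{n\times n}$ is the space of real symmetric $n\times n$ matrices. Matrices $M\in\mathbb{R}^{n\times n}$ are viewed as $m\times m$ block matrices with blocks $M_{ij}\in\mathbb{R}^{d\times d}$. $\nabla f(X)\in\mathbb{S}^{n\times n}$ is the Euclidean gradient of $f$ with respect to $\langle A,B\rangle=\operatorname{trace}(A^\top B)$. $\operatorname{symblockdiag}(M)$ is the matrix with diagonal blocks $(M_{ii}+M_{ii}^\top)/2$ and all other blocks zero. Define $\mathcal{C}=\{X\in\mathbb{S}^{n\times n}: X\succeq 0,\ X_{ii}=I_d,\ i=1,\dots,m\}$. Problem $(\mathrm{P})$: minimize $f(X)$ over $X\in\mathcal{C}$. KKT conditions: $X\in\mathcal{C}$ is a KKT point of $(\mathrm{P})$ if there exist $\hat S\in\mathbb{S}^{n\times n}$ and a symmetric block-diagonal (with $d\times d$ blocks) $\hat\Lambda\in\mathbb{S}^{n\times n}$ such that $\hat SX=0$, $\hat S=\nabla f(X)+\hat\Lambda$ and $\hat S\succeq 0$. *)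

theory Defs
  imports "HOL-Analysis.Analysis"
begin

text \<open>
  Matrices of size \<open>n = m d\<close>, viewed as \<open>m \<times> m\<close> block matrices with \<open>d \<times> d\<close> blocks, have their rows
  and columns indexed by pairs (block index, index inside the block); thus \<open>m = CARD('m)\<close>,
  \<open>d = CARD('d)\<close> and \<open>n = CARD('m \<times> 'd)\<close>, where \<open>m, d \<ge> 1\<close> because types are nonempty.
\<close>

type_synonym ('m, 'd) block_matrix = "real ^ ('m \<times> 'd) ^ ('m \<times> 'd)"

definition block :: "('m::finite, 'd::finite) block_matrix \<Rightarrow> 'm \<Rightarrow> 'm \<Rightarrow> real ^ 'd ^ 'd"
  where "block M i j = (\<chi> a b. M $ (i, a) $ (j, b))"

definition of_blocks :: "('m::finite \<Rightarrow> 'm \<Rightarrow> real ^ 'd ^ 'd) \<Rightarrow> ('m, 'd::finite) block_matrix"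
  where "of_blocks B = (\<chi> p q. B (fst p) (fst q) $ snd p $ snd q)"

definition block_diagonal :: "('m::finite, 'd::finite) block_matrix \<Rightarrow> bool"
  where "block_diagonal M \<longleftrightarrow> (\<forall>i j. i \<noteq> j \<longrightarrow> block M i j = 0)"

definition symblockdiag :: "('m::finite, 'd::finite) block_matrix \<Rightarrow> ('m, 'd) block_matrix"
  where "symblockdiag M =
    of_blocks (\<lambda>i j. if i = j then (1 / 2) *\<^sub>R (block M i i + transpose (block M i i)) else 0)"

definition symmetric_matrices :: "(real ^ 'n ^ 'n) set"
  where "symmetric_matrices = {A. transpose A = A}"

definition psd :: "real ^ 'n ^ 'n \<Rightarrow> bool"
  where "psd A \<longleftrightarrow> A \<in> symmetric_matrices \<and> (\<forall>x. 0 \<le> x \<bullet> (A *v x))"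

text \<open>
  A function on the space of symmetric matrices is represented by a function on all matrices of
  which only the values on \<^const>\<open>symmetric_matrices\<close> matter: derivatives are taken within that
  linear subspace. Such a derivative is only determined on the subspace, but the gradient
  is required to be symmetric, which makes it unique.
\<close>

definition gradient :: "(real ^ 'n ^ 'n \<Rightarrow> real) \<Rightarrow> real ^ 'n ^ 'n \<Rightarrow> real ^ 'n ^ 'n"
  where "gradient f X = (THE G. G \<in> symmetric_matrices \<and>
    (f has_derivative (\<lambda>H. trace (transpose G ** H))) (at X within symmetric_matrices))"

text \<open>
  Meant for \<open>V\<close> a linear subspace. The witnesses are linear maps on the whole space, and
  only their restrictions to \<open>V\<close> are determined by \<open>f\<close>; every linear map on \<open>V\<close> extends to the
  whole space (compose with the orthogonal projection), so this is ordinary \<open>C\<^sup>2\<close>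
  regularity of the restriction of \<open>f\<close> to \<open>V\<close>.
\<close>

definition twice_continuously_differentiable_on ::
    "'a::euclidean_space set \<Rightarrow> ('a \<Rightarrow> real) \<Rightarrow> bool"
  where "twice_continuously_differentiable_on V f \<longleftrightarrow>
    (\<exists>(f' :: 'a \<Rightarrow> 'a \<Rightarrow>\<^sub>L real) (f'' :: 'a \<Rightarrow> 'a \<Rightarrow>\<^sub>L ('a \<Rightarrow>\<^sub>L real)).
      (\<forall>x\<in>V. (f has_derivative blinfun_apply (f' x)) (at x within V)) \<and>
      (\<forall>x\<in>V. (f' has_derivative blinfun_apply (f'' x)) (at x within V)) \<and>
      continuous_on V f'')"

definition feasible_set :: "('m::finite, 'd::finite) block_matrix set"
  where "feasible_set = {X \<in> symmetric_matrices. psd X \<and> (\<forall>i. block X i i = mat 1)}"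

definition dual_certificate ::
    "(('m::finite, 'd::finite) block_matrix \<Rightarrow> real) \<Rightarrow> ('m, 'd) block_matrix \<Rightarrow>
      ('m, 'd) block_matrix \<Rightarrow> bool"
  where "dual_certificate f X S \<longleftrightarrow> S \<in> symmetric_matrices \<and>
    (\<exists>\<Lambda> \<in> symmetric_matrices. block_diagonal \<Lambda> \<and>
      S ** X = 0 \<and> S = gradient f X + \<Lambda> \<and> psd S)"

definition KKT_point ::
    "(('m::finite, 'd::finite) block_matrix \<Rightarrow> real) \<Rightarrow> ('m, 'd) block_matrix \<Rightarrow> bool"
  where "KKT_point f X \<longleftrightarrow> X \<in> feasible_set \<and> (\<exists>S. dual_certificate f X S)"

definition dual_matrix ::
    "(('m::finite, 'd::finite) block_matrix \<Rightarrow> real) \<Rightarrow> ('m, 'd) block_matrix \<Rightarrow>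
      ('m, 'd) block_matrix"
  where "dual_matrix f X = gradient f X - symblockdiag (gradient f X ** X)"

end

theory Submission imports Defs begin

text \<open>
  Since the diagonal blocks of a feasible \<open>X\<close> are identities, the diagonal blocks of the equation
  \<open>(G + \<Lambda>) X = 0\<close> determine \<open>\<Lambda>\<close>, and \<open>trace (D X) = trace D\<close> for block-diagonal \<open>D\<close>.
  The latter gives \<open>trace (S X) = 0\<close> for \<open>S = G - symblockdiag (G X)\<close>; if \<open>S\<close> is
  positive semidefinite, this forces \<open>S X = 0\<close>.
\<close>

section \<open>Positive semidefinite matrices and the trace of their products\<close>

lemma symmetric_inner_commute:
  fixes A :: "real ^ 'n ^ 'n"
  assumes "A \<in> symmetric_matrices"
  shows "x \<bullet> (A *v y) = y \<bullet> (A *v x)"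
  using assms dot_lmul_matrix[of y A x]
  by (simp add: symmetric_matrices_def inner_commute flip: transpose_matrix_vector)

text \<open>The quadratic form attains its minimum at \<open>v\<close>. A small step along
  \<open>- (A *v v)\<close> changes it to first order by a negative multiple of the squared norm of
  \<open>A *v v\<close>, so that vector must vanish.\<close>

lemma psd_kernel:
  fixes A :: "real ^ 'n ^ 'n"
  assumes "psd A" and "v \<bullet> (A *v v) = 0"
  shows "A *v v = 0"
proof (rule ccontr)
  define w where "w = A *v v"
  define a where "a = w \<bullet> w"
  define b where "b = w \<bullet> (A *v w)"
  assume "A *v v \<noteq> 0"
  then have "a > 0" by (simp add: w_def a_def)
  have "b \<ge> 0" using assms by (simp add: psd_def b_def)
  \<comment> \<open>The form at \<open>v - t w\<close> will be \<open>t * (t * b - 2 * a)\<close>.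
    The exact minimiser \<open>a / b\<close> fails for \<open>b = 0\<close>; adding 1 avoids this
    and still gives \<open>t * b \<le> a\<close>, enough to make the value negative.\<close>
  define t where "t = a / (b + 1)"
  have "t > 0" using \<open>a > 0\<close> \<open>b \<ge> 0\<close> by (simp add: t_def)
  have "v \<bullet> (A *v w) = a"
    using assms(1) by (subst symmetric_inner_commute) (auto simp: psd_def a_def w_def)
  moreover have "w \<bullet> (A *v v) = a" by (simp add: a_def w_def)
  ultimately have "(v - t *\<^sub>R w) \<bullet> (A *v (v - t *\<^sub>R w)) = t * (t * b - 2 * a)"
    using assms(2)
    by (simp add: matrix_vector_mult_diff_distrib matrix_vector_mult_scaleR inner_diff_left
        inner_diff_right b_def algebra_simps)
  moreover have "0 \<le> (v - t *\<^sub>R w) \<bullet> (A *v (v - t *\<^sub>R w))"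
    using assms(1) by (simp add: psd_def)
  ultimately have "0 \<le> t * b - 2 * a"
    using \<open>t > 0\<close> by (simp add: zero_le_mult_iff)
  moreover have "t * b \<le> a"
    using \<open>a > 0\<close> \<open>b \<ge> 0\<close> by (simp add: t_def field_simps)
  ultimately show False using \<open>a > 0\<close> by simp
qed

definition outer_square :: "real ^ 'n \<Rightarrow> real ^ 'n ^ 'n"
  where "outer_square v = (\<chi> i j. v $ i * v $ j)"

lemma outer_square_mult: "outer_square v *v x = (v \<bullet> x) *\<^sub>R v"
  by (simp add: vec_eq_iff outer_square_def matrix_vector_mult_def inner_vec_def
      sum_distrib_left mult_ac)

lemma matrix_mult_outer_square:
  "(S ** outer_square v) $ i $ j = (S *v v) $ i * v $ j"
  by (simp add: outer_square_def matrix_matrix_mult_def matrix_vector_mult_def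
      sum_distrib_right mult.assoc)

lemma trace_mult_outer_square: "trace (S ** outer_square v) = v \<bullet> (S *v v)"
  by (simp add: trace_def matrix_mult_outer_square inner_vec_def mult.commute)

text \<open>The diagonal entry is the quadratic form at a standard basis vector, so
  \<open>psd_kernel\<close> annihilates the whole column.\<close>

lemma psd_diag_zero:
  fixes A :: "real ^ 'n ^ 'n"
  assumes "psd A" and "A $ i $ i = 0"
  shows "A $ j $ i = 0"
proof -
  have "axis i 1 \<bullet> (A *v axis i 1) = 0"
    using assms(2) by (simp add: inner_axis' matrix_vector_mult_basis column_def)
  then have "A *v axis i 1 = 0" using psd_kernel assms(1) by blast
  then show ?thesis by (simp add: matrix_vector_mult_basis column_def vec_eq_iff)
qed

text \<open>One step of the Cholesky decomposition.\<close>

lemma psd_eliminate: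
  fixes A :: "real ^ 'n ^ 'n"
  assumes psd: "psd A" and nz: "A $ i $ i \<noteq> 0"
  obtains B v where "A = B + outer_square v" "psd B" "B $ i $ i = 0"
    "\<And>j. A $ j $ j = 0 \<Longrightarrow> B $ j $ j = 0"
proof -
  define c where "c = A $ i $ i"
  define w where "w = A *v axis i 1"
  \<comment> \<open>With this scaling \<open>outer_square v\<close> agrees with \<open>A\<close> in
    row and column \<open>i\<close>, so subtracting it clears both.\<close>
  define v where "v = (1 / sqrt c) *\<^sub>R w"
  define B where "B = A - outer_square v"
  have sym: "A \<in> symmetric_matrices" using psd by (simp add: psd_def)
  have wj: "w $ j = A $ j $ i" for j
    by (simp add: w_def matrix_vector_mult_basis column_def)
  have ii: "axis i 1 \<bullet> w = c" by (simp add: inner_axis' wj c_def)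
  have "c \<ge> 0" using psd by (metis ii psd_def w_def)
  with nz have c: "c > 0" by (simp add: c_def)
  have Bij: "B $ j $ k = A $ j $ k - w $ j * w $ k / c" for j k
    using c by (simp add: B_def outer_square_def v_def)
  have quad: "0 \<le> x \<bullet> (B *v x)" for x
  proof -
    \<comment> \<open>Completing the square: \<open>z\<close> minimises the form of \<open>A\<close>
      on the line through \<open>x\<close> in direction \<open>axis i 1\<close>, and the minimum is
      the form of \<open>B\<close> at \<open>x\<close>.\<close>
    define z where "z = x - ((w \<bullet> x) / c) *\<^sub>R axis i 1"
    have "x \<bullet> (A *v axis i 1) = w \<bullet> x" by (simp add: w_def inner_commute)
    moreover have "axis i 1 \<bullet> (A *v x) = w \<bullet> x"
      by (subst symmetric_inner_commute[OF sym]) (simp add: w_def inner_commute)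
    moreover have "axis i 1 \<bullet> (A *v axis i 1) = c" using ii by (simp add: w_def)
    ultimately have "z \<bullet> (A *v z) = x \<bullet> (A *v x) - (w \<bullet> x)\<^sup>2 / c"
      using c unfolding z_def
      by (simp add: matrix_vector_mult_diff_distrib matrix_vector_mult_scaleR inner_diff_left
          inner_diff_right power2_eq_square field_simps)
    also have "\<dots> = x \<bullet> (B *v x)"
      using c by (simp add: B_def matrix_vector_mult_diff_rdistrib inner_diff_right
          outer_square_mult v_def power2_eq_square inner_commute)
    finally show ?thesis using psd by (metis psd_def)
  qed
  have "transpose B = B"
    using sym by (simp add: vec_eq_iff transpose_def Bij symmetric_matrices_def mult.commute)
  with quad have "psd B" by (simp add: psd_def symmetric_matrices_def)
  moreover have "B $ i $ i = 0" using c by (simp add: Bij wj c_def)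
  \<comment> \<open>Zeros already on the diagonal survive, so repeated elimination makes
    progress.\<close>
  moreover have "B $ j $ j = 0" if "A $ j $ j = 0" for j
  proof -
    have "w $ j = 0"
      using psd_diag_zero[OF psd that, of i] sym
      by (simp add: wj symmetric_matrices_def vec_eq_iff transpose_def)
    with that show ?thesis by (simp add: Bij)
  qed
  ultimately show ?thesis using that[of B v] by (simp add: B_def)
qed

text \<open>Elimination lowers the number of nonzero diagonal entries; when none is left, the matrix
  is zero by \<open>psd_diag_zero\<close>. So every such \<open>A\<close> is a finite sum of
  rank-one outer squares, stated here as an induction rule.\<close>

lemma psd_induct [consumes 1, case_names zero add]:
  fixes A :: "real ^ 'n ^ 'n"
  assumes "psd A" and zero: "P 0" and add: "\<And>B v. P B \<Longrightarrow> P (B + outer_square v)"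
  shows "P A"
  using assms(1)
proof (induction "card {i. A $ i $ i \<noteq> 0}" arbitrary: A rule: less_induct)
  case less
  show ?case
  proof (cases "\<exists>i. A $ i $ i \<noteq> 0")
    case True
    then obtain i where i: "A $ i $ i \<noteq> 0" by blast
    with less.prems obtain B v where B: "A = B + outer_square v" "psd B" "B $ i $ i = 0"
      "\<And>j. A $ j $ j = 0 \<Longrightarrow> B $ j $ j = 0"
      using psd_eliminate by blast
    from i B(3,4) have "{i. B $ i $ i \<noteq> 0} \<subset> {i. A $ i $ i \<noteq> 0}" by blast
    then have "P B" using less.hyps B(2) by (simp add: psubset_card_mono)
    then show ?thesis using add B(1) by simp
  next
    case False
    then have "A = 0" using psd_diag_zero[OF less.prems] by (simp add: vec_eq_iff)
    then show ?thesis using zero by simp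
  qed
qed

text \<open>Each outer square in \<open>X\<close> contributes
  \<open>v \<bullet> (S *v v) \<ge> 0\<close> to the trace. If the trace vanishes, so does each
  contribution, and \<open>psd_kernel\<close> gives \<open>S *v v = 0\<close>. Both claims share one
  induction because the second needs the nonnegativity of the remaining trace.\<close>

lemma psd_trace_mult:
  fixes S X :: "real ^ 'n ^ 'n"
  assumes "psd X" and S: "psd S"
  shows "0 \<le> trace (S ** X) \<and> (trace (S ** X) = 0 \<longrightarrow> S ** X = 0)"
  using assms(1)
proof (induction rule: psd_induct)
  case zero
  show ?case by (simp add: trace_0[unfolded mat_0])
next
  case (add B v)
  have eq: "trace (S ** (B + outer_square v)) = trace (S ** B) + v \<bullet> (S *v v)"
    by (simp add: matrix_add_ldistrib trace_add trace_mult_outer_square)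
  have nonneg: "0 \<le> v \<bullet> (S *v v)" using S by (simp add: psd_def)
  have "S ** (B + outer_square v) = 0" if "trace (S ** (B + outer_square v)) = 0"
  proof -
    from that eq nonneg add.IH have "S ** B = 0" "v \<bullet> (S *v v) = 0" by auto
    moreover from this S have "S *v v = 0" using psd_kernel by blast
    ultimately show ?thesis
      by (simp add: matrix_add_ldistrib vec_eq_iff matrix_mult_outer_square)
  qed
  with eq nonneg add.IH show ?case by simp
qed

section \<open>Block calculus and the operator \<open>symblockdiag\<close>\<close>

lemma matrix_add_rdistrib:
  fixes A B :: "'a::semiring_1 ^ 'n ^ 'm"
  shows "(A + B) ** C = A ** C + B ** C"
  by (simp add: matrix_matrix_mult_def vec_eq_iff distrib_right sum.distrib)

lemma matrix_diff_rdistrib: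
  fixes A B :: "'a::ring_1 ^ 'n ^ 'm"
  shows "(A - B) ** C = A ** C - B ** C"
  by (simp add: matrix_matrix_mult_def vec_eq_iff left_diff_distrib sum_subtractf)

lemma block_eq_iff: "M = N \<longleftrightarrow> (\<forall>i j. block M i j = block N i j)"
  by (auto simp: block_def vec_eq_iff)

lemma block_add: "block (M + N) i j = block M i j + block N i j"
  by (simp add: block_def vec_eq_iff)

lemma block_zero [simp]: "block 0 i j = 0"
  by (simp add: block_def vec_eq_iff)

lemma block_transpose: "block (transpose M) i j = transpose (block M j i)"
  by (simp add: block_def vec_eq_iff transpose_def)

lemma block_mult: "block (M ** N) i j = (\<Sum>k\<in>UNIV. block M i k ** block N k j)"
  by (simp add: block_def vec_eq_iff matrix_matrix_mult_def flip: UNIV_Times_UNIV)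
     (simp add: sum.cartesian_product)

lemma trace_block: "trace M = (\<Sum>i\<in>UNIV. trace (block M i i))"
  by (simp add: trace_def block_def sum.cartesian_product flip: UNIV_Times_UNIV)

lemma block_symblockdiag:
  "block (symblockdiag M) i j =
    (if i = j then (1 / 2) *\<^sub>R (block M i i + transpose (block M i i)) else 0)"
  by (simp add: symblockdiag_def of_blocks_def block_def vec_eq_iff)

lemma block_diagonal_symblockdiag: "block_diagonal (symblockdiag M)"
  by (simp add: block_diagonal_def block_symblockdiag)

lemma symblockdiag_symmetric: "symblockdiag M \<in> symmetric_matrices"
  by (simp add: symmetric_matrices_def block_eq_iff block_transpose block_symblockdiag)
     (simp add: vec_eq_iff transpose_def)

lemma trace_symblockdiag: "trace (symblockdiag M) = trace M"
  by (simp add: trace_block block_symblockdiag) (simp add: trace_def transpose_def)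

text \<open>Only the term \<open>k = i\<close> of the block product survives, and there the block of
  \<open>X\<close> is the identity.\<close>

lemma block_diagonal_mult_diag:
  assumes "block_diagonal D" and "X \<in> feasible_set"
  shows "block (D ** X) i i = block D i i"
proof -
  have "block (D ** X) i i = (\<Sum>k\<in>UNIV. if k = i then block D i i else 0)"
    unfolding block_mult using assms
    by (intro sum.cong) (auto simp: block_diagonal_def feasible_set_def)
  then show ?thesis by simp
qed

text \<open>Symmetrisation leaves the diagonal blocks of the symmetric \<open>\<Lambda>\<close>
  unchanged. This lets a multiplier be recovered from the diagonal blocks alone.\<close>

lemma symblockdiag_of_diag_blocks:
  assumes "block_diagonal \<Lambda>" "\<Lambda> \<in> symmetric_matrices"
    and "\<And>i. block M i i = - block \<Lambda> i i"
  shows "symblockdiag M = - \<Lambda>"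
proof -
  have "transpose (block \<Lambda> i i) = block \<Lambda> i i" for i
    using assms(2) block_transpose[of \<Lambda> i i] by (simp add: symmetric_matrices_def)
  then have "block \<Lambda> i i $ a $ b = block \<Lambda> i i $ b $ a" for i a b
    by (metis transpose_def vec_lambda_beta)
  then show ?thesis
    using assms(1,3) unfolding block_eq_iff block_symblockdiag
    by (auto simp: block_diagonal_def vec_eq_iff transpose_def block_def)
qed

section \<open>Uniqueness and existence of the dual certificate\<close>

lemma dual_certificate_eq:
  assumes X: "X \<in> feasible_set" and "dual_certificate f X S"
  shows "S = dual_matrix f X"
proof -
  from assms(2) obtain \<Lambda> where L: "\<Lambda> \<in> symmetric_matrices" "block_diagonal \<Lambda>"
    and SX: "S ** X = 0" and S: "S = gradient f X + \<Lambda>"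
    unfolding dual_certificate_def by blast
  have "block (gradient f X ** X) i i = - block \<Lambda> i i" for i
  proof -
    have "block (gradient f X ** X) i i + block (\<Lambda> ** X) i i = 0"
      using SX by (simp add: S matrix_add_rdistrib flip: block_add)
    then show ?thesis
      using block_diagonal_mult_diag[OF L(2) X] by (simp add: eq_neg_iff_add_eq_0)
  qed
  then have "symblockdiag (gradient f X ** X) = - \<Lambda>"
    using L symblockdiag_of_diag_blocks by blast
  then show ?thesis by (simp add: dual_matrix_def S)
qed

lemma dual_certificate_dual_matrix:
  assumes X: "X \<in> feasible_set" and psd: "psd (dual_matrix f X)"
  shows "dual_certificate f X (dual_matrix f X)"
proof -
  define D where "D = symblockdiag (gradient f X ** X)"
  have D: "block_diagonal D" "D \<in> symmetric_matrices"
    by (simp_all add: D_def block_diagonal_symblockdiag symblockdiag_symmetric)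
  have "trace (D ** X) = trace D"
    using block_diagonal_mult_diag[OF D(1) X] by (simp add: trace_block)
  then have "trace (dual_matrix f X ** X) = 0"
    by (simp add: dual_matrix_def matrix_diff_rdistrib trace_sub trace_symblockdiag flip: D_def)
       (simp add: D_def trace_symblockdiag)
  then have "dual_matrix f X ** X = 0"
    using psd_trace_mult[OF _ psd] X by (simp add: feasible_set_def)
  \<comment> \<open>The multiplier \<open>\<Lambda>\<close> is \<open>- D\<close>.\<close>
  moreover have "block_diagonal (- D)" "- D \<in> symmetric_matrices"
    using D by (auto simp: block_diagonal_def symmetric_matrices_def block_def transpose_def
        vec_eq_iff)
  moreover have "dual_matrix f X = gradient f X + - D"
    by (simp add: dual_matrix_def D_def)
  ultimately show ?thesis
    using psd unfolding dual_certificate_def by (auto simp: psd_def)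
qed

theorem theorem3p3:
  fixes f :: "('m::finite, 'd::finite) block_matrix \<Rightarrow> real"
    and X :: "('m, 'd) block_matrix"
  assumes "twice_continuously_differentiable_on symmetric_matrices f"
    and "X \<in> feasible_set"
  shows "(KKT_point f X \<longleftrightarrow> psd (dual_matrix f X)) \<and>
    (KKT_point f X \<longrightarrow> (\<forall>S. dual_certificate f X S \<longleftrightarrow> S = dual_matrix f X))"
proof -
  \<comment> \<open>Quantifying \<open>S\<close> existentially gives the KKT criterion; once that
    holds, the second conjunct is true and the equivalence becomes uniqueness.\<close>
  have "dual_certificate f X S \<longleftrightarrow> S = dual_matrix f X \<and> psd (dual_matrix f X)" for S
    using dual_certificate_eq[OF assms(2)] dual_certificate_dual_matrix[OF assms(2)]
    by (metis dual_certificate_def)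
  then show ?thesis using assms(2) by (auto simp: KKT_point_def)
qed

end
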